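(* Let $(\boldsymbol X_1,Y_1),\ldots,(\boldsymbol X_n,Y_n)$ be i.i.d. copies of a random pair $(\boldsymbol X,Y)\in\mathbb R^d\times\mathbb R$ following the regression model $Y=\varphi(\boldsymbol X)+\varepsilon$ with $\mathbb E(\varepsilon\mid\boldsymbol X)=0$ and $\mathbb E(\varepsilon^2\mid\boldsymbol X)<\infty$ almost surely. Let $$\widetilde{\mathcal Q}:=\{(\psi(\boldsymbol X_1),\ldots,\psi(\boldsymbol X_n)):\ \psi:\mathbb R^d\to\mathbb R\text{ quasiconvex}\}\subseteq\mathbb R^n .$$ Then the optimization problem $\min_{\boldsymbol z\in\widetilde{\mathcal Q}}\sum_{k=1}^n(Y_k-z_k)^2$ has a minimizer $\widetilde{\boldsymbol\theta}\in\widetilde{\mathcal Q}$. Moreover, if $Y$ has a density with respect to the Lebesgue measure on $\mathbb R$, then the minimizer $\widetilde{\boldsymbol\theta}$ is unique with probability $1$.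
   Context: $\psi:\mathbb R^d\to\mathbb R$ is quasiconvex if $\psi(\lambda\boldsymbol x+(1-\lambda)\boldsymbol y)\le\max\{\psi(\boldsymbol x),\psi(\boldsymbol y)\}$ for all $\boldsymbol x,\boldsymbol y\in\mathbb R^d$ and $\lambda\in[0,1]$. *)

theory Defs
  imports "HOL-Probability.Probability"
begin

definition quasiconvex :: "('a::real_vector \<Rightarrow> real) \<Rightarrow> bool" where
  "quasiconvex \<psi> \<longleftrightarrow>
     (\<forall>x y. \<forall>t\<in>{0..1}. \<psi> (t *\<^sub>R x + (1 - t) *\<^sub>R y) \<le> max (\<psi> x) (\<psi> y))"

(* The set Q~ for given design points x.  The sample is indexed by an arbitrary
   finite type 'n with CARD('n) = n, so that Q~ is a subset of real^'n. *)
definition quasiconvex_values :: "('n::finite \<Rightarrow> 'a::real_vector) \<Rightarrow> (real^'n) set" where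
  "quasiconvex_values x = {(\<chi> k. \<psi> (x k)) | \<psi>. quasiconvex \<psi>}"

definition sum_of_squares :: "('n::finite \<Rightarrow> real) \<Rightarrow> real^'n \<Rightarrow> real" where
  "sum_of_squares y z = (\<Sum>k\<in>UNIV. (y k - z $ k)\<^sup>2)"

abbreviation is_quasiconvex_lse ::
    "('n::finite \<Rightarrow> 'a::real_vector) \<Rightarrow> ('n \<Rightarrow> real) \<Rightarrow> real^'n \<Rightarrow> bool" where
  "is_quasiconvex_lse x y \<equiv> is_arg_min (sum_of_squares y) (\<lambda>z. z \<in> quasiconvex_values x)"

(* vimage_algebra (space M) X borel is the sigma-algebra generated by X.
   Integrability of the error e is not required: a finite conditional second moment makes
   the conditional expectations of the positive and negative parts of e finite almost
   surely, and real_cond_exp is by definition the difference of these two. *)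
definition regression_model ::
    "'w measure \<Rightarrow> ('w \<Rightarrow> 'a::euclidean_space) \<Rightarrow> ('w \<Rightarrow> real) \<Rightarrow> ('a \<Rightarrow> real) \<Rightarrow> ('w \<Rightarrow> real) \<Rightarrow> bool"
  where
  "regression_model M X Y \<phi> e \<longleftrightarrow>
     X \<in> borel_measurable M \<and> Y \<in> borel_measurable M \<and> e \<in> borel_measurable M \<and>
     (AE \<omega> in M. Y \<omega> = \<phi> (X \<omega>) + e \<omega>) \<and>
     (AE \<omega> in M. real_cond_exp M (vimage_algebra (space M) X borel) e \<omega> = 0) \<and>
     (AE \<omega> in M. nn_cond_exp M (vimage_algebra (space M) X borel)
                    (\<lambda>\<omega>'. ennreal ((e \<omega>')\<^sup>2)) \<omega> < \<infinity>)"

definition iid_copies ::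
    "'w measure \<Rightarrow> 'b measure \<Rightarrow> ('n \<Rightarrow> 'w \<Rightarrow> 'b) \<Rightarrow> ('w \<Rightarrow> 'b) \<Rightarrow> bool" where
  "iid_copies M N Zs Z \<longleftrightarrow>
     prob_space.indep_vars M (\<lambda>_. N) Zs UNIV \<and> (\<forall>k. distr M N (Zs k) = distr M N Z)"

end

theory Submission
  imports Defs
begin

text \<open>
  A vector \<open>z\<close> consists of the values of a quasiconvex function at \<open>x\<^sub>1, \<dots>, x\<^sub>n\<close> iff
  \<open>z\<^sub>k \<le> max {z\<^sub>j. j \<in> S}\<close> whenever \<open>x\<^sub>k\<close> lies in the convex hull of \<open>{x\<^sub>j. j \<in> S}\<close>. Hence the
  set of these vectors is closed, which gives existence, and it is one of finitely many closed
  sets \<open>C\<close>, whatever the design points are, so it suffices to treat each fixed \<open>C\<close>.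

  For a fixed closed \<open>C\<close> and a coordinate \<open>k\<close>, the \<open>k\<close>-th coordinate of a nearest point in \<open>C\<close> is
  monotone along every line in direction \<open>e\<^sub>k\<close>. For \<open>a < b\<close> each such line therefore contains at most
  one point that has one nearest point with \<open>k\<close>-th coordinate at most \<open>a\<close> and another with
  \<open>k\<close>-th coordinate at least \<open>b\<close>. By Fubini's theorem these points form a null set for every product
  of atomless distributions, and rational \<open>a < b\<close> suffice to capture all non-uniqueness.
\<close>

section \<open>Values of quasiconvex functions at finitely many points\<close>

lemma quasiconvex_sublevel_convex:
  assumes "quasiconvex \<psi>"
  shows "convex {p. \<psi> p \<le> c}"
proof (rule convexI)
  fix p q and u v :: real
  assume "p \<in> {p. \<psi> p \<le> c}" "q \<in> {p. \<psi> p \<le> c}" and uv: "0 \<le> u" "0 \<le> v" "u + v = 1"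
  then have "max (\<psi> p) (\<psi> q) \<le> c" by simp
  moreover have "\<psi> (u *\<^sub>R p + (1 - u) *\<^sub>R q) \<le> max (\<psi> p) (\<psi> q)"
    using assms uv by (auto simp: quasiconvex_def)
  moreover have "v = 1 - u" using uv by simp
  ultimately show "u *\<^sub>R p + v *\<^sub>R q \<in> {p. \<psi> p \<le> c}" by (simp del: max.bounded_iff)
qed

text \<open>
  The extension of \<open>z\<close> takes at \<open>p\<close> the smallest value \<open>c\<close> of \<open>z\<close> such that \<open>p\<close> lies in the convex
  hull of the design points with value at most \<open>c\<close>, and \<open>Max z\<close> if there is no such value.
\<close>

lemma quasiconvex_extension:
  fixes x :: "'n::finite \<Rightarrow> 'a::real_vector" and z :: "real^'n"
  assumes z: "\<And>k S. x k \<in> convex hull (x ` S) \<Longrightarrow> \<exists>j\<in>S. z $ k \<le> z $ j"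
  shows "\<exists>\<psi>. quasiconvex \<psi> \<and> (\<forall>k. \<psi> (x k) = z $ k)"
proof -
  define H where "H c = convex hull (x ` {j. z $ j \<le> c})" for c
  define m where "m = Max (range (($) z))"
  \<comment> \<open>As \<open>m\<close> is the largest value of \<open>z\<close>, inserting it makes
    \<open>L p\<close> nonempty without lowering a minimum that already exists.\<close>
  define L where "L p = insert m {c \<in> range (($) z). p \<in> H c}" for p
  define \<psi> where "\<psi> p = Min (L p)" for p
  have fin [simp]: "finite (L p)" for p by (simp add: L_def)
  have H_mono: "H c \<subseteq> H d" if "c \<le> d" for c d
    unfolding H_def using that by (intro hull_mono) auto
  have \<psi>_le: "\<psi> p \<le> c" if "c \<in> L p" for c p
    unfolding \<psi>_def using that by simp
  have \<psi>_in: "\<psi> p \<in> L p" for p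
    unfolding \<psi>_def by (rule Min_in) (auto simp: L_def)
  have "quasiconvex \<psi>"
    unfolding quasiconvex_def
  proof (intro allI ballI)
    fix p q and t :: real assume t: "t \<in> {0..1}"
    let ?c = "max (\<psi> p) (\<psi> q)" and ?r = "t *\<^sub>R p + (1 - t) *\<^sub>R q"
    show "\<psi> ?r \<le> ?c"
    \<comment> \<open>If neither value is \<open>m\<close>, both are genuine levels, and the hull of
      the larger one contains \<open>p\<close> and \<open>q\<close>.\<close>
    proof (cases "\<psi> p = m \<or> \<psi> q = m")
      case True
      have "\<psi> ?r \<le> m" by (rule \<psi>_le) (simp add: L_def)
      then show ?thesis using True by auto
    next
      case False
      then have pq: "\<psi> p \<in> range (($) z)" "p \<in> H (\<psi> p)" "\<psi> q \<in> range (($) z)" "q \<in> H (\<psi> q)"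
        using \<psi>_in[of p] \<psi>_in[of q] by (auto simp: L_def)
      then have "p \<in> H ?c" "q \<in> H ?c"
        using H_mono[of "\<psi> p" ?c] H_mono[of "\<psi> q" ?c] by auto
      then have "?r \<in> H ?c"
        using t convex_convex_hull unfolding H_def by (intro convexD) auto
      moreover have "?c \<in> range (($) z)" using pq by (simp add: max_def)
      ultimately show ?thesis by (intro \<psi>_le) (simp add: L_def)
    qed
  qed
  moreover have "\<psi> (x k) = z $ k" for k
  proof (rule antisym)
    show "\<psi> (x k) \<le> z $ k"
      by (rule \<psi>_le) (auto simp: L_def H_def intro!: hull_inc)
    have "z $ k \<le> m" by (simp add: m_def)
    \<comment> \<open>No level below \<open>z $ k\<close> has \<open>x k\<close> in its hull: this
      is the hypothesis for the index set \<open>{j. z $ j \<le> c}\<close>.\<close>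
    moreover have "z $ k \<le> c" if "x k \<in> H c" for c
      using z[of k "{j. z $ j \<le> c}"] that by (force simp: H_def)
    ultimately show "z $ k \<le> \<psi> (x k)"
      using \<psi>_in[of "x k"] by (auto simp: L_def)
  qed
  ultimately show ?thesis by blast
qed

text \<open>This is all that the constraint set retains of the design points. For finite
  \<open>'n\<close> there are finitely many patterns, so null sets for the individual patterns
  suffice for a random design.\<close>

definition hull_pattern :: "('n \<Rightarrow> 'a::real_vector) \<Rightarrow> ('n \<times> 'n set) set" where
  "hull_pattern x = {(k, S). x k \<in> convex hull (x ` S)}"

definition pattern_values :: "('n \<times> 'n set) set \<Rightarrow> (real^'n) set" where
  "pattern_values R = {z. \<forall>(k, S)\<in>R. \<exists>j\<in>S. z $ k \<le> z $ j}"

text \<open>A convex sublevel set containing the points indexed by \<open>S\<close> contains their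
  hull; taking the maximum over \<open>S\<close> as level gives one inclusion. The extension gives
  the other.\<close>

lemma quasiconvex_values_eq_pattern_values:
  fixes x :: "'n::finite \<Rightarrow> 'a::real_vector"
  shows "quasiconvex_values x = pattern_values (hull_pattern x)"
proof (intro set_eqI iffI)
  fix z assume "z \<in> quasiconvex_values x"
  then obtain \<psi> where \<psi>: "quasiconvex \<psi>" and z: "z = (\<chi> k. \<psi> (x k))"
    by (auto simp: quasiconvex_values_def)
  have "\<exists>j\<in>S. \<psi> (x k) \<le> \<psi> (x j)" if k: "x k \<in> convex hull (x ` S)" for k S
  proof -
    let ?m = "Max ((\<lambda>j. \<psi> (x j)) ` S)"
    have "S \<noteq> {}" using k by auto
    then have "?m \<in> (\<lambda>j. \<psi> (x j)) ` S" by (intro Max_in) auto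
    then obtain j where "j \<in> S" "?m = \<psi> (x j)" by blast
    moreover have "x k \<in> {p. \<psi> p \<le> ?m}"
    proof (rule subsetD[OF hull_minimal k])
      show "convex {p. \<psi> p \<le> ?m}" by (rule quasiconvex_sublevel_convex[OF \<psi>])
    qed auto
    ultimately show ?thesis by auto
  qed
  then show "z \<in> pattern_values (hull_pattern x)"
    by (auto simp: z pattern_values_def hull_pattern_def)
next
  fix z assume "z \<in> pattern_values (hull_pattern x)"
  then have "\<exists>\<psi>. quasiconvex \<psi> \<and> (\<forall>k. \<psi> (x k) = z $ k)"
    by (intro quasiconvex_extension) (auto simp: pattern_values_def hull_pattern_def)
  then obtain \<psi> where "quasiconvex \<psi>" "\<forall>k. \<psi> (x k) = z $ k" by blast
  then show "z \<in> quasiconvex_values x"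
    by (auto simp: quasiconvex_values_def vec_eq_iff intro!: exI[of _ \<psi>])
qed

text \<open>Each condition is a finite union of closed sets
  \<open>{z. z $ k \<le> z $ j}\<close>.\<close>

lemma closed_pattern_values: "closed (pattern_values R :: (real^'n::finite) set)"
proof -
  have "pattern_values R = (\<Inter>(k, S)\<in>R. \<Union>j\<in>S. {z :: real^'n. z $ k \<le> z $ j})"
    by (auto simp: pattern_values_def)
  also have "closed \<dots>"
    by (auto intro!: closed_INT closed_UN closed_Collect_le continuous_intros)
  finally show ?thesis .
qed

lemma zero_in_quasiconvex_values: "0 \<in> quasiconvex_values x"
  by (auto simp: quasiconvex_values_def quasiconvex_def vec_eq_iff intro!: exI[of _ "\<lambda>_. 0"])

section \<open>Nearest points in a closed set\<close>

abbreviation is_nearest :: "'a::metric_space set \<Rightarrow> 'a \<Rightarrow> 'a \<Rightarrow> bool" where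
  "is_nearest C u \<theta> \<equiv> is_arg_min (dist u) (\<lambda>z. z \<in> C) \<theta>"

lemma is_quasiconvex_lse_iff_is_nearest:
  "is_quasiconvex_lse x y \<theta> \<longleftrightarrow> is_nearest (quasiconvex_values x) (\<chi> k. y k) \<theta>"
proof -
  have "sum_of_squares y z = (dist (\<chi> k. y k) z)\<^sup>2" for z
    by (simp add: sum_of_squares_def dist_vec_def L2_set_def dist_real_def sum_nonneg)
  then have "sum_of_squares y z \<le> sum_of_squares y w \<longleftrightarrow> dist (\<chi> k. y k) z \<le> dist (\<chi> k. y k) w" for z w
    by (simp only: power_mono_iff zero_le_dist zero_less_numeral)
  then show ?thesis by (simp add: is_arg_min_linorder)
qed

lemma closed_nearest_exists:
  fixes C :: "'a::heine_borel set"
  assumes "closed C" "C \<noteq> {}"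
  shows "\<exists>\<theta>. is_nearest C u \<theta>"
proof -
  obtain \<theta> where "\<theta> \<in> C" "infdist u C = dist u \<theta>"
    using infdist_attains_inf[OF assms] .
  then show ?thesis
    using infdist_le[of _ C u] by (force simp: is_arg_min_linorder)
qed

text \<open>Some nearest point lies in \<open>H\<close> iff \<open>C \<inter> H\<close> is as close
  to \<open>u\<close> as \<open>C\<close> is, and both distances are continuous in
  \<open>u\<close>.\<close>

lemma closed_nearest_in:
  fixes C :: "'a::heine_borel set"
  assumes "closed C" "closed H"
  shows "closed {u. \<exists>\<theta>\<in>H. is_nearest C u \<theta>}"
\<comment> \<open>The empty case is separate because \<open>infdist\<close> to the empty set is 0 by
  convention.\<close>
proof (cases "C \<inter> H = {}")
  case True
  then have "{u. \<exists>\<theta>\<in>H. is_nearest C u \<theta>} = {}" by (auto simp: is_arg_min_def)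
  then show ?thesis by simp
next
  case False
  have "(\<exists>\<theta>\<in>H. is_nearest C u \<theta>) \<longleftrightarrow> infdist u (C \<inter> H) \<le> infdist u C" for u
  proof
    assume "\<exists>\<theta>\<in>H. is_nearest C u \<theta>"
    then obtain \<theta> where \<theta>: "\<theta> \<in> C \<inter> H" "\<And>w. w \<in> C \<Longrightarrow> dist u \<theta> \<le> dist u w"
      by (auto simp: is_arg_min_linorder)
    obtain w where w: "w \<in> C" "infdist u C = dist u w"
      using infdist_attains_inf[of C u] assms False by auto
    show "infdist u (C \<inter> H) \<le> infdist u C"
      using infdist_le[OF \<theta>(1), of u] \<theta>(2)[OF w(1)] w(2) by simp
  next
    assume le: "infdist u (C \<inter> H) \<le> infdist u C"
    obtain \<theta> where \<theta>: "\<theta> \<in> C \<inter> H" "infdist u (C \<inter> H) = dist u \<theta>"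
      using infdist_attains_inf[of "C \<inter> H" u] assms False by auto
    have "dist u \<theta> \<le> dist u w" if "w \<in> C" for w
      using infdist_le[OF that, of u] le \<theta>(2) by simp
    then show "\<exists>\<theta>\<in>H. is_nearest C u \<theta>"
      using \<theta>(1) by (auto simp: is_arg_min_linorder)
  qed
  then show ?thesis
    by (simp add: closed_Collect_le continuous_on_infdist continuous_on_id)
qed

text \<open>In the sum of the two squared minimality inequalities the squared norms cancel, leaving
  twice the inner product. This works for any \<open>C\<close>, convex or not.\<close>

lemma nearest_monotone:
  fixes u v :: "'a::real_inner"
  assumes "is_nearest C u \<theta>" "is_nearest C v \<eta>"
  shows "0 \<le> (v - u) \<bullet> (\<eta> - \<theta>)"
proof -
  have "dist u \<theta> \<le> dist u \<eta>" "dist v \<eta> \<le> dist v \<theta>"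
    using assms by (auto simp: is_arg_min_linorder)
  then have "(u - \<theta>) \<bullet> (u - \<theta>) \<le> (u - \<eta>) \<bullet> (u - \<eta>)"
    "(v - \<eta>) \<bullet> (v - \<eta>) \<le> (v - \<theta>) \<bullet> (v - \<theta>)"
    by (auto simp: dist_norm norm_le)
  then show ?thesis by (simp add: inner_simps inner_commute)
qed

text \<open>The two nearest points are quantified separately, so that for closed \<open>C\<close>
  this is an intersection of two closed sets and hence Borel.\<close>

definition split_points :: "(real^'n) set \<Rightarrow> 'n \<Rightarrow> real \<Rightarrow> real \<Rightarrow> (real^'n::finite) set" where
  "split_points C k a b =
     {u. \<exists>\<theta>\<in>{z. z $ k \<le> a}. is_nearest C u \<theta>} \<inter> {u. \<exists>\<theta>\<in>{z. b \<le> z $ k}. is_nearest C u \<theta>}"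

lemma closed_split_points: "closed C \<Longrightarrow> closed (split_points C k a b)"
  unfolding split_points_def
  by (intro closed_Int closed_nearest_in closed_Collect_le continuous_intros)

text \<open>Monotonicity, applied to a nearest point of \<open>u\<close> with coordinate at least
  \<open>b\<close> and one of \<open>v\<close> with coordinate at most \<open>a\<close>, forces
  \<open>v $ k \<le> u $ k\<close>. Exchanging \<open>u\<close> and \<open>v\<close> gives
  equality.\<close>

lemma split_points_line:
  assumes "a < b" and u: "u \<in> split_points C k a b" and v: "v \<in> split_points C k a b"
    and line: "\<And>j. j \<noteq> k \<Longrightarrow> u $ j = v $ j"
  shows "u = v"
proof -
  have le: "u $ k \<ge> v $ k"
    if uv: "u \<in> split_points C k a b" "v \<in> split_points C k a b"
      and line: "\<And>j. j \<noteq> k \<Longrightarrow> u $ j = v $ j" for u v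
  proof -
    obtain \<theta> \<eta> where near: "is_nearest C u \<theta>" "b \<le> \<theta> $ k" "is_nearest C v \<eta>" "\<eta> $ k \<le> a"
      using uv by (auto simp: split_points_def)
    have "0 \<le> (v - u) \<bullet> (\<eta> - \<theta>)" using near by (intro nearest_monotone)
    also have "\<dots> = (\<Sum>j\<in>UNIV. if j = k then (v $ k - u $ k) * (\<eta> $ k - \<theta> $ k) else 0)"
      unfolding inner_vec_def by (rule sum.cong) (use line in auto)
    also have "\<dots> = (v $ k - u $ k) * (\<eta> $ k - \<theta> $ k)" by simp
    finally show ?thesis
      using near \<open>a < b\<close> by (auto simp: zero_le_mult_iff)
  qed
  have "u $ k = v $ k" using le[OF u v] le[OF v u] line by force
  then show ?thesis using line by (metis vec_eq_iff)
qed

text \<open>Two rationals fit between differing coordinates, so countably many exceptional sets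
  cover all non-uniqueness.\<close>

lemma nonunique_nearest_split:
  assumes "is_nearest C u \<theta>" "is_nearest C u \<eta>" "\<theta> \<noteq> \<eta>"
  shows "\<exists>k. \<exists>a\<in>\<rat>. \<exists>b\<in>\<rat>. a < b \<and> u \<in> split_points C k a b"
proof -
  have split: "\<exists>a\<in>\<rat>. \<exists>b\<in>\<rat>. a < b \<and> u \<in> split_points C k a b"
    if near: "is_nearest C u \<theta>" "is_nearest C u \<eta>" "\<theta> $ k < \<eta> $ k" for \<theta> \<eta> k
  proof -
    obtain a where a: "a \<in> \<rat>" "\<theta> $ k < a" "a < \<eta> $ k" using Rats_dense_in_real[OF near(3)] by auto
    obtain b where b: "b \<in> \<rat>" "a < b" "b < \<eta> $ k" using Rats_dense_in_real[OF a(3)] by auto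
    have "u \<in> split_points C k a b"
      unfolding split_points_def
    proof (intro IntI CollectI bexI)
      show "is_nearest C u \<theta>" "is_nearest C u \<eta>" by fact+
      show "\<theta> $ k \<le> a" "b \<le> \<eta> $ k" using a b by auto
    qed
    then show ?thesis using a b by blast
  qed
  obtain k where "\<theta> $ k \<noteq> \<eta> $ k" using assms(3) by (auto simp: vec_eq_iff)
  then show ?thesis
    using split[OF assms(1,2)] split[OF assms(2,1)] by (meson linorder_neq_iff)
qed

section \<open>Atomless product distributions\<close>

lemma measurable_vec_lambda:
  "(\<lambda>f. \<chi> k. f k) \<in> borel_measurable (\<Pi>\<^sub>M k\<in>UNIV. (borel :: real measure))"
  by (subst borel_measurable_euclidean_space) (auto simp: Basis_vec_def inner_axis)

text \<open>By Tonelli's theorem the indicator of \<open>B\<close> can be integrated over coordinate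
  \<open>i\<close> first, which gives 0 on every line.\<close>

lemma null_sets_PiM_lines:
  fixes N :: "'i \<Rightarrow> 'b measure"
  assumes N: "\<And>i. sigma_finite_measure (N i)" and "finite I" "i \<in> I"
    and B: "B \<in> sets (Pi\<^sub>M I N)"
    and lines: "\<And>f. f \<in> space (Pi\<^sub>M (I - {i}) N) \<Longrightarrow> AE t in N i. f(i := t) \<notin> B"
  shows "B \<in> null_sets (Pi\<^sub>M I N)"
proof -
  interpret product_sigma_finite N using N by (rule product_sigma_finite.intro)
  let ?J = "I - {i}"
  have I: "insert i ?J = I" using \<open>i \<in> I\<close> by auto
  have "emeasure (Pi\<^sub>M I N) B = (\<integral>\<^sup>+ f. indicator B f \<partial>Pi\<^sub>M (insert i ?J) N)"
    unfolding I using B by simp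
  also have "\<dots> = (\<integral>\<^sup>+ f. (\<integral>\<^sup>+ t. indicator B (f(i := t)) \<partial>N i) \<partial>Pi\<^sub>M ?J N)"
    using B \<open>finite I\<close> by (intro product_nn_integral_insert) (auto simp only: I finite_Diff
      borel_measurable_indicator)
  also have "\<dots> = (\<integral>\<^sup>+ f. 0 \<partial>Pi\<^sub>M ?J N)"
  proof (rule nn_integral_cong)
    fix f assume "f \<in> space (Pi\<^sub>M ?J N)"
    then have "AE t in N i. indicator B (f(i := t)) = (0 :: ennreal)"
      using lines by (auto simp: indicator_def elim!: eventually_mono)
    then show "(\<integral>\<^sup>+ t. indicator B (f(i := t)) \<partial>N i) = 0"
      by (subst nn_integral_cong_AE[where v = "\<lambda>_. 0"]) auto
  qed
  also have "\<dots> = 0" by simp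
  finally show ?thesis using B by auto
qed

lemma split_points_null:
  fixes C :: "(real^'n::finite) set" and N :: "real measure"
  assumes "closed C" "a < b" and N: "sigma_finite_measure N" "sets N = sets borel"
    and atomless: "\<And>t. {t} \<in> null_sets N"
  shows "AE y in (\<Pi>\<^sub>M k\<in>UNIV. N). (\<chi> k. y k) \<notin> split_points C k a b"
proof -
  let ?P = "\<Pi>\<^sub>M k\<in>(UNIV :: 'n set). N"
  define B where "B = {y \<in> space ?P. (\<chi> k. y k) \<in> split_points C k a b}"
  have [measurable]: "split_points C k a b \<in> sets borel"
    using closed_split_points[OF \<open>closed C\<close>] by (rule borel_closed)
  have [measurable]: "(\<lambda>f. \<chi> k. f k) \<in> borel_measurable ?P"
    using measurable_vec_lambda N(2) by (simp cong: measurable_cong_sets sets_PiM_cong)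
  have meas: "B \<in> sets ?P" unfolding B_def by measurable
  have "B \<in> null_sets ?P"
  proof (rule null_sets_PiM_lines[where i = k])
    fix f :: "'n \<Rightarrow> real"
    let ?T = "{t. f(k := t) \<in> B}"
    \<comment> \<open>The points \<open>f(k := s)\<close> and \<open>f(k := t)\<close> differ at
      most in coordinate \<open>k\<close>, so the slice has at most one element.\<close>
    have "s = t" if "s \<in> ?T" "t \<in> ?T" for s t
    proof -
      have "(\<chi> j. (f(k := s)) j) = (\<chi> j. (f(k := t)) j)"
        by (rule split_points_line[OF \<open>a < b\<close>, of _ C k]) (use that in \<open>auto simp: B_def simp del: fun_upd_apply\<close>, simp)
      then show ?thesis by (metis fun_upd_same vec_lambda_beta)
    qed
    then obtain s where "?T \<subseteq> {s}" by blast
    then show "AE t in N. f(k := t) \<notin> B"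
      by (intro AE_I'[OF atomless[of s]]) auto
  qed (use N meas in auto)
  then show ?thesis
    by (intro AE_I'[of B]) (auto simp: B_def)
qed

text \<open>Independence passes to the images of the pairs under \<open>snd\<close>, and the law of
  each \<open>Ys k\<close> is the image of the common joint law.\<close>

lemma (in prob_space) iid_copies_snd_distr:
  fixes Xs :: "'n::finite \<Rightarrow> 'a \<Rightarrow> 'b::topological_space" and Ys :: "'n \<Rightarrow> 'a \<Rightarrow> 'c::topological_space"
  assumes iid: "iid_copies M (borel \<Otimes>\<^sub>M borel) (\<lambda>k \<omega>. (Xs k \<omega>, Ys k \<omega>)) (\<lambda>\<omega>. (X \<omega>, Y \<omega>))"
    and XY [measurable]: "X \<in> borel_measurable M" "Y \<in> borel_measurable M"
  shows "(\<lambda>\<omega> k. Ys k \<omega>) \<in> measurable M (\<Pi>\<^sub>M k\<in>UNIV. borel)"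
    and "distr M (\<Pi>\<^sub>M k\<in>UNIV. borel) (\<lambda>\<omega> k. Ys k \<omega>) = (\<Pi>\<^sub>M k\<in>UNIV. distr M borel Y)"
proof -
  have indep: "indep_vars (\<lambda>_. borel \<Otimes>\<^sub>M borel) (\<lambda>k \<omega>. (Xs k \<omega>, Ys k \<omega>)) UNIV"
    and eq: "\<And>k. distr M (borel \<Otimes>\<^sub>M borel) (\<lambda>\<omega>. (Xs k \<omega>, Ys k \<omega>)) =
                  distr M (borel \<Otimes>\<^sub>M borel) (\<lambda>\<omega>. (X \<omega>, Y \<omega>))"
    using iid by (auto simp: iid_copies_def)
  have rv: "(\<lambda>\<omega>. (Xs k \<omega>, Ys k \<omega>)) \<in> measurable M (borel \<Otimes>\<^sub>M borel)" for k
    using indep by (auto simp: indep_vars_def)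
  have Ys [measurable]: "Ys k \<in> borel_measurable M" for k
    using measurable_compose[OF rv measurable_snd] by simp
  have "indep_vars (\<lambda>_. borel) (\<lambda>k \<omega>. snd (Xs k \<omega>, Ys k \<omega>)) UNIV"
    by (rule indep_vars_compose2[OF indep]) simp
  then have "indep_vars (\<lambda>_. borel) Ys UNIV" by simp
  then have "distr M (\<Pi>\<^sub>M k\<in>UNIV. borel) (\<lambda>\<omega> k. Ys k \<omega>) = (\<Pi>\<^sub>M k\<in>UNIV. distr M borel (Ys k))"
    by (subst (asm) indep_vars_iff_distr_eq_PiM) (auto simp: restrict_UNIV)
  moreover have "distr M borel (Ys k) = distr M borel Y" for k
  proof -
    have "distr M borel (Ys k) =
        distr (distr M (borel \<Otimes>\<^sub>M borel) (\<lambda>\<omega>. (Xs k \<omega>, Ys k \<omega>))) borel snd"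
      using rv by (subst distr_distr) (auto simp: comp_def)
    also have "\<dots> = distr M borel Y"
      by (simp add: eq distr_distr comp_def)
    finally show ?thesis .
  qed
  ultimately show "distr M (\<Pi>\<^sub>M k\<in>UNIV. borel) (\<lambda>\<omega> k. Ys k \<omega>) = (\<Pi>\<^sub>M k\<in>UNIV. distr M borel Y)"
    by simp
  show "(\<lambda>\<omega> k. Ys k \<omega>) \<in> measurable M (\<Pi>\<^sub>M k\<in>UNIV. borel)"
    by (rule measurable_PiM_single') auto
qed

lemma distributed_lborel_atomless:
  fixes Y :: "'w \<Rightarrow> 'a::euclidean_space"
  assumes "distributed M lborel Y f"
  shows "{t} \<in> null_sets (distr M borel Y)"
proof -
  have "distr M borel Y = distr M lborel Y" by (rule distr_cong) auto
  also have "\<dots> = density lborel f" using assms by (simp add: distributed_def)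
  finally have eq: "distr M borel Y = density lborel f" .
  have f: "f \<in> borel_measurable lborel" using assms by (simp add: distributed_def)
  have "AE s in lborel. s \<in> {t} \<longrightarrow> f s = 0"
    using AE_lborel_singleton[of t] by (rule eventually_mono) simp
  then show ?thesis
    unfolding eq null_sets_density_iff[OF f] by simp
qed

theorem theorem4p1:
  fixes M :: "'w measure"
    and X :: "'w \<Rightarrow> real^'d" and Y \<epsilon> :: "'w \<Rightarrow> real" and \<phi> :: "real^'d \<Rightarrow> real"
    and Xs :: "'n::finite \<Rightarrow> 'w \<Rightarrow> real^'d" and Ys :: "'n \<Rightarrow> 'w \<Rightarrow> real"
  assumes "prob_space M"
    and "regression_model M X Y \<phi> \<epsilon>"
    and "iid_copies M (borel \<Otimes>\<^sub>M borel) (\<lambda>k \<omega>. (Xs k \<omega>, Ys k \<omega>)) (\<lambda>\<omega>. (X \<omega>, Y \<omega>))"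
  shows "(\<forall>\<omega>\<in>space M. \<exists>\<theta>. is_quasiconvex_lse (\<lambda>k. Xs k \<omega>) (\<lambda>k. Ys k \<omega>) \<theta>) \<and>
         ((\<exists>f. distributed M lborel Y f) \<longrightarrow>
            (AE \<omega> in M. \<exists>!\<theta>. is_quasiconvex_lse (\<lambda>k. Xs k \<omega>) (\<lambda>k. Ys k \<omega>) \<theta>))"
proof (intro conjI impI)
  interpret prob_space M by fact
  have ex: "\<exists>\<theta>. is_quasiconvex_lse x y \<theta>" for x :: "'n \<Rightarrow> real^'d" and y
    unfolding is_quasiconvex_lse_iff_is_nearest
    by (rule closed_nearest_exists)
      (use zero_in_quasiconvex_values[of x] in
        \<open>auto simp: quasiconvex_values_eq_pattern_values closed_pattern_values\<close>)
  then show "\<forall>\<omega>\<in>space M. \<exists>\<theta>. is_quasiconvex_lse (\<lambda>k. Xs k \<omega>) (\<lambda>k. Ys k \<omega>) \<theta>" by blast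
  assume "\<exists>f. distributed M lborel Y f"
  then have atomless: "{t} \<in> null_sets (distr M borel Y)" for t
    using distributed_lborel_atomless by blast
  have XY [measurable]: "X \<in> borel_measurable M" "Y \<in> borel_measurable M"
    using assms(2) by (auto simp: regression_model_def)
  note Ys = iid_copies_snd_distr[OF assms(3) XY]
  interpret D: prob_space "distr M borel Y" by (rule prob_space_distr) simp
  \<comment> \<open>The pattern \<open>R\<close> is fixed before \<open>\<omega>\<close>, so only
    the law of the responses enters here, not their dependence on the design.\<close>
  have null: "AE \<omega> in M. (\<chi> k. Ys k \<omega>) \<notin> split_points (pattern_values R) k a b"
    if "a < b" for R k a b
  proof -
    have "AE y in distr M (\<Pi>\<^sub>M k\<in>UNIV. borel) (\<lambda>\<omega> k. Ys k \<omega>).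
        (\<chi> k. y k) \<notin> split_points (pattern_values R) k a b"
      unfolding Ys(2) using that atomless
      by (intro split_points_null closed_pattern_values) (auto intro: D.sigma_finite_measure_axioms)
    then show ?thesis by (rule AE_distrD[OF Ys(1)])
  qed
  \<comment> \<open>\<open>R\<close> and \<open>k\<close> range over finite types and
    \<open>a\<close>, \<open>b\<close> over a countable set, so the exceptional null sets have a
    null union.\<close>
  have "AE \<omega> in M. \<forall>R k. \<forall>a\<in>\<rat>. \<forall>b\<in>\<rat>. a < b \<longrightarrow>
      (\<chi> k. Ys k \<omega>) \<notin> split_points (pattern_values R) k a b"
    by (subst AE_all_countable AE_ball_countable[OF countable_rat], intro allI ballI)+
      (use null in auto)
  then show "AE \<omega> in M. \<exists>!\<theta>. is_quasiconvex_lse (\<lambda>k. Xs k \<omega>) (\<lambda>k. Ys k \<omega>) \<theta>"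
  proof (rule eventually_mono)
    fix \<omega>
    assume "\<forall>R k. \<forall>a\<in>\<rat>. \<forall>b\<in>\<rat>. a < b \<longrightarrow>
      (\<chi> k. Ys k \<omega>) \<notin> split_points (pattern_values R) k a b"
    \<comment> \<open>The constraint set at \<open>\<omega>\<close> belongs to the hull pattern of
      the design at \<open>\<omega>\<close>, which is one of the patterns \<open>R\<close>.\<close>
    then have "\<theta> = \<eta>"
      if "is_quasiconvex_lse (\<lambda>k. Xs k \<omega>) (\<lambda>k. Ys k \<omega>) \<theta>"
        "is_quasiconvex_lse (\<lambda>k. Xs k \<omega>) (\<lambda>k. Ys k \<omega>) \<eta>" for \<theta> \<eta>
      using nonunique_nearest_split[OF that[unfolded is_quasiconvex_lse_iff_is_nearest,
            unfolded quasiconvex_values_eq_pattern_values]]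
      by blast
    then show "\<exists>!\<theta>. is_quasiconvex_lse (\<lambda>k. Xs k \<omega>) (\<lambda>k. Ys k \<omega>) \<theta>"
      using ex by blast
  qed
qed

end
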